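(* Let $d\ge 2$ and $k\ge 0$ be integers. For a set $S$ of $n$ points in convex position and in general linear position in $\mathbb{R}^d$, $$e_k(S)\le\frac{n}{d}\,e_k^{(d-1)}(n-1).$$
   Context: A set of at least $d+1$ points in $\mathbb{R}^d$ is in general linear position if no $d+1$ (and thus no fewer) of its points are affinely dependent. A finite set is in convex position if each of its points is a vertex of its convex hull. For a finite set $S\subset\mathbb{R}^d$ in general linear position, a $k$-facet of $S$ is a pair consisting of a subset $\Delta\subset S$ of $d$ points and an orientation of the hyperplane $\operatorname{aff}\Delta$ such that the open halfspace on the positive side of $\operatorname{aff}\Delta$ contains exactly $k$ points of $S$ (the two orientations of the same hyperplane count as different). $e_k(S)$ denotes the number of $k$-facets of $S$, and $e_k^{(d)}(n)$ denotes the maximum number of $k$-facets that a set of $n$ points in general linear position in $\mathbb{R}^d$ can have. *)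

theory Defs
  imports "HOL-Analysis.Analysis"
begin

definition general_linear_position :: "'a::euclidean_space set \<Rightarrow> bool" where
  "general_linear_position S \<longleftrightarrow>
     (infinite S \<or> card S \<ge> DIM('a) + 1) \<and>
     (\<forall>T\<subseteq>S. card T = DIM('a) + 1 \<longrightarrow> \<not> affine_dependent T)"

definition convex_position :: "'a::euclidean_space set \<Rightarrow> bool" where
  "convex_position S \<longleftrightarrow> finite S \<and> (\<forall>x\<in>S. x extreme_point_of (convex hull S))"

text \<open>An orientation of a hyperplane is encoded by the open halfspace on its positive side, so
  that the two orientations of the same hyperplane give two distinct pairs. This is meant for
  finite sets in general linear position.\<close>

definition k_facets :: "nat \<Rightarrow> 'a::euclidean_space set \<Rightarrow> ('a set \<times> 'a set) set" where
  "k_facets k S =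
     {(\<Delta>, H). \<Delta> \<subseteq> S \<and> card \<Delta> = DIM('a) \<and>
        (\<exists>a b. a \<noteq> 0 \<and> affine hull \<Delta> = {x. a \<bullet> x = b} \<and> H = {x. a \<bullet> x > b}) \<and>
        card (S \<inter> H) = k}"

definition num_k_facets :: "nat \<Rightarrow> 'a::euclidean_space set \<Rightarrow> nat" where
  "num_k_facets k S = card (k_facets k S)"

text \<open>The dimension is passed as a type. The set below is bounded by twice the number of subsets
  of size \<open>DIM('a)\<close> of a set of size \<open>n\<close>, and it is nonempty if \<open>n \<ge> DIM('a) + 1\<close>;
  for smaller \<open>n\<close> it is empty and the value has no meaning.\<close>

definition max_num_k_facets :: "'a::euclidean_space itself \<Rightarrow> nat \<Rightarrow> nat \<Rightarrow> nat" where
  "max_num_k_facets _ k n =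
     Max {num_k_facets k S | S :: 'a set. finite S \<and> card S = n \<and> general_linear_position S}"

end

theory Submission imports Defs begin

text \<open>
  For a vertex \<open>p\<close> of \<open>S\<close>, project \<open>S - {p}\<close> centrally from \<open>p\<close> onto a hyperplane that separates
  \<open>p\<close> from the other points. Hyperplanes through \<open>p\<close> correspond to hyperplanes of the image, and the
  sides are preserved because all points of \<open>S - {p}\<close> lie on the same side of a hyperplane
  through \<open>p\<close>. Hence the \<open>k\<close>-facets of \<open>S\<close> containing \<open>p\<close> inject into the \<open>k\<close>-facets of a set
  of \<open>n - 1\<close> points in dimension \<open>d - 1\<close>. Summing over \<open>p\<close> counts every \<open>k\<close>-facet \<open>d\<close> times.
\<close>

section \<open>Affine independence and hyperplanes\<close>

text \<open>Both sides say that the affine dimension of \<open>T\<close> is full. The hyperplane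
  form is the one that a central projection can transport.\<close>

lemma not_affine_dependent_iff_not_subset_hyperplane:
  fixes T :: "'a::euclidean_space set"
  assumes "card T = DIM('a) + 1"
  shows "\<not> affine_dependent T \<longleftrightarrow> (\<forall>a b. a \<noteq> 0 \<longrightarrow> \<not> T \<subseteq> {x. a \<bullet> x = b})"
proof -
  have fin: "finite T"
    using assms card.infinite by fastforce
  have "\<not> affine_dependent T \<longleftrightarrow> aff_dim T = DIM('a)"
    using affine_independent_iff_card[of T] fin assms by simp
  also have "\<dots> \<longleftrightarrow> \<not> aff_dim T < DIM('a)"
    using aff_dim_le_DIM[of T] by linarith
  also have "\<dots> \<longleftrightarrow> (\<forall>a b. a \<noteq> 0 \<longrightarrow> \<not> T \<subseteq> {x. a \<bullet> x = b})"
  proof -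
    have "aff_dim T < DIM('a)" if "a \<noteq> 0" "T \<subseteq> {x. a \<bullet> x = b}" for a b
      using aff_dim_subset[OF that(2)] aff_dim_hyperplane[OF that(1), of b]
        DIM_positive[where 'a='a] by linarith
    moreover have "\<exists>a b. a \<noteq> 0 \<and> T \<subseteq> {x. a \<bullet> x = b}" if "aff_dim T < DIM('a)"
      using aff_lowdim_subset_hyperplane[OF that] by metis
    ultimately show ?thesis
      by blast
  qed
  finally show ?thesis .
qed

lemma affine_hull_eq_hyperplane:
  fixes T :: "'a::euclidean_space set"
  assumes "\<not> affine_dependent T" "card T = DIM('a)" "a \<noteq> 0" "T \<subseteq> {x. a \<bullet> x = b}"
  shows "affine hull T = {x. a \<bullet> x = b}"
proof (rule affine_dim_equal)
  show "affine hull T \<noteq> {}"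
    using assms(2) DIM_positive[where 'a='a] by force
  show "affine hull T \<subseteq> {x. a \<bullet> x = b}"
    using assms(4) by (simp add: affine_hyperplane hull_minimal)
  show "aff_dim (affine hull T) = aff_dim {x. a \<bullet> x = b}"
    using assms aff_dim_affine_independent[OF assms(1)] by simp
qed (auto simp: affine_hyperplane)

text \<open>The definition constrains only subsets of exactly \<open>DIM('a) + 1\<close> points.
  Smaller subsets inherit independence from such a superset, which exists because \<open>S\<close>
  has enough points.\<close>

lemma general_linear_position_extend:
  fixes S :: "'a::euclidean_space set"
  assumes "general_linear_position S" "finite S" "T \<subseteq> S" "card T \<le> DIM('a) + 1"
  obtains U where "T \<subseteq> U" "U \<subseteq> S" "card U = DIM('a) + 1" "\<not> affine_dependent U"
proof -
  have "DIM('a) + 1 \<le> card S"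
    using assms unfolding general_linear_position_def by blast
  then obtain U where "T \<subseteq> U" "U \<subseteq> S" "card U = DIM('a) + 1"
    using assms(2-4) exists_subset_between by metis
  with that assms(1) show thesis
    unfolding general_linear_position_def by blast
qed

lemma general_linear_position_not_subset_hyperplane:
  fixes S :: "'a::euclidean_space set"
  assumes "general_linear_position S" "finite S" "a \<noteq> 0"
  shows "\<not> S \<subseteq> {x. a \<bullet> x = b}"
proof -
  obtain U where "U \<subseteq> S" "card U = DIM('a) + 1" "\<not> affine_dependent U"
    using general_linear_position_extend[OF assms(1,2), of "{}"] by auto
  then show ?thesis
    using not_affine_dependent_iff_not_subset_hyperplane assms(3) by blast
qed

section \<open>Finiteness of the set of k-facets\<close>

text \<open>A hyperplane has only two open sides. If two opposite sides met \<open>S\<close> in the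
  same points, no point of \<open>S\<close> would lie off the hyperplane.\<close>

lemma k_facets_snd_eqI:
  fixes S :: "'a::euclidean_space set"
  assumes "general_linear_position S" "finite S"
    and "(\<Delta>, H) \<in> k_facets k S" "(\<Delta>, H') \<in> k_facets k S" "S \<inter> H = S \<inter> H'"
  shows "H = H'"
proof (rule ccontr)
  assume "H \<noteq> H'"
  obtain a b where ab: "a \<noteq> 0" "affine hull \<Delta> = {x. a \<bullet> x = b}" "H = {x. a \<bullet> x > b}"
    using assms(3) unfolding k_facets_def by blast
  obtain a' b' where ab': "a' \<noteq> 0" "affine hull \<Delta> = {x. a' \<bullet> x = b'}" "H' = {x. a' \<bullet> x > b'}"
    using assms(4) unfolding k_facets_def by blast
  let ?N = "{x. a \<bullet> x = b}"
  have eq: "?N = {x. a' \<bullet> x = b'}"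
    using ab(2) ab'(2) by simp
  \<comment> \<open>Two affine functions with the same zero set are proportional. The factor
    \<open>r\<close> comes from evaluating the second one at the foot of the perpendicular from
    \<open>x\<close> to the hyperplane.\<close>
  define r where "r = (a' \<bullet> a) / (a \<bullet> a)"
  have rel: "a' \<bullet> x - b' = r * (a \<bullet> x - b)" for x
  proof -
    have "x - ((a \<bullet> x - b) / (a \<bullet> a)) *\<^sub>R a \<in> ?N"
      using ab(1) by (simp add: inner_diff_right)
    then show ?thesis
      unfolding eq r_def by (simp add: inner_diff_right field_simps)
  qed
  have "r \<noteq> 0"
  proof
    assume "r = 0"
    then have "a' \<bullet> x = b'" for x
      using rel[of x] by simp
    from this[of 0] this[of a'] ab'(1) show False by simp
  qed
  have "H' = {x. r * (a \<bullet> x - b) > 0}"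
    unfolding ab'(3) rel[symmetric] by simp
  moreover have "\<not> r > 0"
    using \<open>H \<noteq> H'\<close> ab(3) calculation by (auto simp: zero_less_mult_iff)
  ultimately have H': "H' = {x. a \<bullet> x < b}"
    using \<open>r \<noteq> 0\<close> by (auto simp: zero_less_mult_iff)
  have "S \<subseteq> ?N"
  proof
    fix x assume "x \<in> S"
    then have "a \<bullet> x > b \<longleftrightarrow> a \<bullet> x < b"
      using assms(5) ab(3) H' by blast
    then show "x \<in> ?N" by auto
  qed
  then show False
    using general_linear_position_not_subset_hyperplane assms(1,2) ab(1) by blast
qed

text \<open>Replacing the halfspace by its trace on \<open>S\<close> places the k-facets in the
  finite set \<open>Pow S \<times> Pow S\<close>.\<close>

lemma inj_on_k_facets:
  fixes S :: "'a::euclidean_space set"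
  assumes "general_linear_position S" "finite S"
  shows "inj_on (\<lambda>(\<Delta>, H). (\<Delta>, S \<inter> H)) (k_facets k S)"
  using k_facets_snd_eqI[OF assms] by (auto simp: inj_on_def)

lemma
  fixes S :: "'a::euclidean_space set"
  assumes "general_linear_position S" "finite S"
  shows finite_k_facets: "finite (k_facets k S)"
    and num_k_facets_le: "num_k_facets k S \<le> 2 ^ card S * 2 ^ card S"
proof -
  have sub: "(\<lambda>(\<Delta>, H). (\<Delta>, S \<inter> H)) ` k_facets k S \<subseteq> Pow S \<times> Pow S"
    by (auto simp: k_facets_def)
  have fin: "finite (Pow S \<times> Pow S)"
    using assms(2) by simp
  show "finite (k_facets k S)"
    using inj_on_finite[OF inj_on_k_facets[OF assms] sub fin] .
  show "num_k_facets k S \<le> 2 ^ card S * 2 ^ card S"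
    using card_inj_on_le[OF inj_on_k_facets[OF assms] sub fin] assms(2)
    by (simp add: num_k_facets_def card_cartesian_product card_Pow)
qed

text \<open>\<open>Max\<close> is meaningful only on a finite set. The preceding bound depends on
  \<open>card S\<close> alone, hence holds for all competitors at once.\<close>

lemma num_k_facets_le_max:
  fixes S :: "'a::euclidean_space set"
  assumes "general_linear_position S" "finite S"
  shows "num_k_facets k S \<le> max_num_k_facets TYPE('a) k (card S)"
proof -
  let ?A = "{num_k_facets k T | T :: 'a set. finite T \<and> card T = card S \<and> general_linear_position T}"
  have "?A \<subseteq> {..2 ^ card S * 2 ^ card S}"
    using num_k_facets_le by (smt (verit) atMost_iff mem_Collect_eq subsetI)
  then have "finite ?A"
    using finite_subset by blast
  then show ?thesis
    unfolding max_num_k_facets_def using assms by (intro Max_ge) auto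
qed

section \<open>Central projection from a vertex\<close>

lemma convex_position_strict_support:
  fixes S :: "'a::euclidean_space set"
  assumes "convex_position S" "p \<in> S"
  obtains c where "\<And>x. x \<in> S - {p} \<Longrightarrow> c \<bullet> (x - p) > 0"
proof -
  have fin: "finite S"
    using assms unfolding convex_position_def by blast
  \<comment> \<open>Otherwise dropping \<open>p\<close> would not change the hull, whose extreme
    points would then all lie in \<open>S - {p}\<close>.\<close>
  have "p \<notin> convex hull (S - {p})"
  proof
    assume p: "p \<in> convex hull (S - {p})"
    have "p extreme_point_of (convex hull S)"
      using assms unfolding convex_position_def by blast
    moreover have "convex hull S = convex hull (S - {p})"
      using p assms(2) by (metis hull_redundant_eq insert_Diff)
    ultimately show False
      using extreme_point_of_convex_hull by fastforce
  qed
  moreover have "closed (convex hull (S - {p}))"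
    using fin by (simp add: compact_imp_closed finite_imp_compact_convex_hull)
  ultimately obtain c b where c: "c \<bullet> p < b" "\<And>x. x \<in> convex hull (S - {p}) \<Longrightarrow> b < c \<bullet> x"
    using separating_hyperplane_closed_point[of "convex hull (S - {p})" p] by auto
  show thesis
  proof (rule that)
    fix x assume "x \<in> S - {p}"
    then have "b < c \<bullet> x"
      using c(2) hull_inc by metis
    with c(1) show "c \<bullet> (x - p) > 0"
      by (simp add: inner_diff_right)
  qed
qed

text \<open>Equality of \<open>sgn\<close> records incidence and both sides at once. The first
  property pulls hyperplanes back and serves general position; the second pushes hyperplanes through
  \<open>p\<close> forward and serves k-facets.\<close>

lemma central_projection:
  fixes S :: "'a::euclidean_space set"
  assumes dim: "DIM('a) = DIM('b::euclidean_space) + 1"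
    and "convex_position S" "p \<in> S" "S \<noteq> {p}"
  obtains \<pi> :: "'a \<Rightarrow> 'b::euclidean_space"
  where "\<And>u \<beta>. u \<noteq> 0 \<Longrightarrow>
           \<exists>a. a \<noteq> 0 \<and> (\<forall>x\<in>S - {p}. sgn (a \<bullet> x - a \<bullet> p) = sgn (u \<bullet> \<pi> x - \<beta>))"
    and "\<And>a. \<exists>u \<beta>. \<forall>x\<in>S - {p}. sgn (a \<bullet> x - a \<bullet> p) = sgn (u \<bullet> \<pi> x - \<beta>)"
proof -
  obtain c where c: "\<And>x. x \<in> S - {p} \<Longrightarrow> c \<bullet> (x - p) > 0"
    using convex_position_strict_support assms by metis
  have "c \<noteq> 0"
    using c assms(3,4) by force
  \<comment> \<open>The target is the type \<open>'b\<close>, so \<open>f\<close> identifies it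
    isometrically with the orthogonal complement of \<open>c\<close>.\<close>
  have "dim (UNIV :: 'b set) = dim {y. c \<bullet> y = 0}"
    using dim dim_hyperplane[OF \<open>c \<noteq> 0\<close>] by simp
  then obtain f :: "'b \<Rightarrow> 'a" where f: "linear f" "range f = {y. c \<bullet> y = 0}"
    "\<And>x. norm (f x) = norm x"
    using isometries_subspaces[OF subspace_UNIV subspace_hyperplane]
    by (metis UNIV_I)
  \<comment> \<open>The scaling moves \<open>x - p\<close> along its ray to height 1 in direction
    \<open>c\<close>. Then \<open>adjoint f\<close> reads off the coordinates of its component
    orthogonal to \<open>c\<close>.\<close>
  define \<pi> where "\<pi> x = adjoint f ((x - p) /\<^sub>R (c \<bullet> (x - p)))" for x
  \<comment> \<open>Every normal vector has the form \<open>f u - \<beta> c\<close>, and the positive factor \<open>c \<bullet> (x - p)\<close> does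
    not affect signs.\<close>
  have key: "sgn ((f u - \<beta> *\<^sub>R c) \<bullet> x - (f u - \<beta> *\<^sub>R c) \<bullet> p) = sgn (u \<bullet> \<pi> x - \<beta>)"
    if "x \<in> S - {p}" for u \<beta> x
  proof -
    have pos: "c \<bullet> (x - p) > 0"
      using c that by blast
    have "u \<bullet> \<pi> x = f u \<bullet> (x - p) / (c \<bullet> (x - p))"
      unfolding \<pi>_def by (simp add: adjoint_works[OF f(1)] divide_inverse_commute)
    then have "(f u - \<beta> *\<^sub>R c) \<bullet> x - (f u - \<beta> *\<^sub>R c) \<bullet> p = (c \<bullet> (x - p)) * (u \<bullet> \<pi> x - \<beta>)"
      using pos by (simp add: field_simps inner_diff_left inner_diff_right)
    then show ?thesis
      using pos by (simp add: sgn_mult)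
  qed
  show thesis
  proof (rule that)
    fix u \<beta> assume "(u :: 'b) \<noteq> 0"
    then have "f u \<noteq> 0"
      using f(3) by (metis norm_eq_zero)
    have orth: "c \<bullet> f u = 0"
      using f(2) by blast
    have "f u - \<beta> *\<^sub>R c \<noteq> 0"
    proof
      assume "f u - \<beta> *\<^sub>R c = 0"
      then have "f u \<bullet> f u = \<beta> * (c \<bullet> f u)"
        by (metis eq_iff_diff_eq_0 inner_scaleR_left)
      with orth \<open>f u \<noteq> 0\<close> show False by simp
    qed
    with key show "\<exists>a. a \<noteq> 0 \<and> (\<forall>x\<in>S - {p}. sgn (a \<bullet> x - a \<bullet> p) = sgn (u \<bullet> \<pi> x - \<beta>))"
      by blast
  next
    fix a
    \<comment> \<open>This \<beta> makes \<open>a + \<beta> *\<^sub>R c\<close> orthogonal to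
      \<open>c\<close>, so that it lies in the range of \<open>f\<close>.\<close>
    define \<beta> where "\<beta> = - (c \<bullet> a) / (c \<bullet> c)"
    have "c \<bullet> (a + \<beta> *\<^sub>R c) = 0"
      using \<open>c \<noteq> 0\<close> by (simp add: \<beta>_def inner_diff_right)
    then obtain u where "f u = a + \<beta> *\<^sub>R c"
      using f(2) by (metis (mono_tags, lifting) imageE mem_Collect_eq)
    then have "a = f u - \<beta> *\<^sub>R c" by simp
    with key show "\<exists>u \<beta>. \<forall>x\<in>S - {p}. sgn (a \<bullet> x - a \<bullet> p) = sgn (u \<bullet> \<pi> x - \<beta>)"
      by blast
  qed
qed

section \<open>The k-facets containing a given point\<close>

lemma card_k_facets_at_point_le:
  fixes S :: "'a::euclidean_space set"
  assumes dim: "DIM('a) = DIM('b::euclidean_space) + 1"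
    and cp: "convex_position S" and glp: "general_linear_position S" and p: "p \<in> S"
  shows "card {F \<in> k_facets k S. p \<in> fst F} \<le> max_num_k_facets TYPE('b::euclidean_space) k (card S - 1)"
proof -
  have fin: "finite S"
    using cp unfolding convex_position_def by blast
  have cardS: "card S \<ge> DIM('a) + 1"
    using glp fin unfolding general_linear_position_def by blast
  then have "S \<noteq> {p}" by auto
  then obtain \<pi> :: "'a \<Rightarrow> 'b"
    where up: "\<And>u \<beta>. u \<noteq> 0 \<Longrightarrow>
           \<exists>a. a \<noteq> 0 \<and> (\<forall>x\<in>S - {p}. sgn (a \<bullet> x - a \<bullet> p) = sgn (u \<bullet> \<pi> x - \<beta>))"
      and down: "\<And>a. \<exists>u \<beta>. \<forall>x\<in>S - {p}. sgn (a \<bullet> x - a \<bullet> p) = sgn (u \<bullet> \<pi> x - \<beta>)"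
    using central_projection[OF dim cp p] by metis
  define S' where "S' = \<pi> ` (S - {p})"
  \<comment> \<open>A hyperplane containing the image of \<open>T\<close> would pull back to one
    containing \<open>p\<close> and \<open>T\<close>, which are \<open>DIM('a) + 1\<close> points of
    \<open>S\<close>.\<close>
  have aff_dim: "aff_dim (\<pi> ` T) = DIM('b)" if T: "T \<subseteq> S - {p}" "card T = DIM('a)" for T
  proof (rule ccontr)
    assume "aff_dim (\<pi> ` T) \<noteq> DIM('b)"
    then have "aff_dim (\<pi> ` T) < DIM('b)"
      using aff_dim_le_DIM[of "\<pi> ` T"] by linarith
    then obtain u \<beta> where u: "u \<noteq> 0" "\<pi> ` T \<subseteq> {y. u \<bullet> y = \<beta>}"
      using aff_lowdim_subset_hyperplane by blast
    then obtain a where a: "a \<noteq> 0" "\<forall>x\<in>S - {p}. sgn (a \<bullet> x - a \<bullet> p) = sgn (u \<bullet> \<pi> x - \<beta>)"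
      using up by blast
    have "a \<bullet> x = a \<bullet> p" if "x \<in> T" for x
    proof -
      have "x \<in> S - {p}" "u \<bullet> \<pi> x = \<beta>"
        using T(1) u(2) that by auto
      then have "sgn (a \<bullet> x - a \<bullet> p) = 0"
        using a(2) by simp
      then show ?thesis
        by (simp add: sgn_zero_iff)
    qed
    then have sub: "insert p T \<subseteq> {x. a \<bullet> x = a \<bullet> p}" by blast
    have "card (insert p T) = DIM('a) + 1"
      using T fin by (metis Diff_iff Suc_eq_plus1 card_insert_disjoint finite_Diff finite_subset
          insertI1 subsetD)
    moreover from this have "\<not> affine_dependent (insert p T)"
      using glp T(1) p unfolding general_linear_position_def by blast
    ultimately show False
      using not_affine_dependent_iff_not_subset_hyperplane a(1) sub by blast
  qed
  have finT: "finite T" if "T \<subseteq> S - {p}" for T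
    using fin that finite_subset by blast
  \<comment> \<open>Affine dimension \<open>DIM('b)\<close> takes at least
    \<open>DIM('b) + 1 = DIM('a)\<close> distinct points, so none can be identified.\<close>
  have inj_T: "inj_on \<pi> T" if T: "T \<subseteq> S - {p}" "card T = DIM('a)" for T
  proof (rule eq_card_imp_inj_on)
    show "finite T" using finT T by blast
    have "aff_dim (\<pi> ` T) \<le> int (card (\<pi> ` T)) - 1"
      using aff_dim_le_card[of "\<pi> ` T"] finT[OF T(1)] by simp
    then show "card (\<pi> ` T) = card T"
      using aff_dim[OF T] dim T(2) card_image_le[OF finT[OF T(1)], of \<pi>] by linarith
  qed
  have cardSp: "card (S - {p}) = card S - 1"
    using p fin by simp
  \<comment> \<open>As \<open>DIM('a)\<close> is at least 2, any two points lie in a common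
    \<open>T\<close> of the size treated above.\<close>
  have inj: "inj_on \<pi> (S - {p})"
  proof (rule inj_onI)
    fix x y assume xy: "x \<in> S - {p}" "y \<in> S - {p}" "\<pi> x = \<pi> y"
    have "card {x, y} \<le> DIM('a)"
      using dim DIM_positive[where 'a='b] card_length[of "[x, y]"]
      unfolding list.set list.size by linarith
    moreover have "DIM('a) \<le> card (S - {p})"
      using cardS cardSp by linarith
    ultimately obtain T where "{x, y} \<subseteq> T" "T \<subseteq> S - {p}" "card T = DIM('a)"
      using exists_subset_between[of "{x, y}" "DIM('a)" "S - {p}"] xy fin by auto
    then show "x = y"
      using inj_T xy(3) by (metis inj_onD insert_subset)
  qed
  have cardS': "card S' = card S - 1"
    unfolding S'_def using card_image[OF inj] cardSp by simp
  have finS': "finite S'"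
    unfolding S'_def using fin by blast
  have glp': "general_linear_position S'"
    unfolding general_linear_position_def
  proof (intro conjI allI impI)
    show "infinite S' \<or> DIM('b) + 1 \<le> card S'"
      using cardS cardS' dim by linarith
    fix T' assume T': "T' \<subseteq> S'" "card T' = DIM('b) + 1"
    then obtain T where T: "T \<subseteq> S - {p}" "T' = \<pi> ` T"
      unfolding S'_def by (meson subset_imageE)
    then have "card T = DIM('a)"
      using T'(2) dim card_image inj inj_on_subset by metis
    then have "aff_dim T' = int (card T') - 1"
      using aff_dim T T'(2) by simp
    then show "\<not> affine_dependent T'"
      using affine_independent_iff_card finS' T'(1) finite_subset by blast
  qed
  define A where "A = {F \<in> k_facets k S. p \<in> fst F}"
  \<comment> \<open>The image facet is described by its trace on \<open>S'\<close>, because traces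
    are what lets the original halfspace be recovered later.\<close>
  have lift: "\<exists>G \<in> k_facets k S'. fst G = \<pi> ` (fst F - {p}) \<and> S' \<inter> snd G = \<pi> ` (S \<inter> snd F)"
    if FA: "F \<in> A" for F
  proof -
    obtain \<Delta> H where F: "F = (\<Delta>, H)" by fastforce
    have \<Delta>: "\<Delta> \<subseteq> S" "card \<Delta> = DIM('a)" "p \<in> \<Delta>" and cardH: "card (S \<inter> H) = k"
      using FA unfolding A_def F k_facets_def by auto
    obtain a b where ab: "a \<noteq> 0" "affine hull \<Delta> = {x. a \<bullet> x = b}" "H = {x. a \<bullet> x > b}"
      using FA unfolding A_def F k_facets_def by auto
    have on: "a \<bullet> x = b" if "x \<in> \<Delta>" for x
      using that ab(2) hull_inc[of x \<Delta>] by blast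
    then have bp: "b = a \<bullet> p" using \<Delta>(3) by auto
    obtain u \<beta> where u: "\<forall>x\<in>S - {p}. sgn (a \<bullet> x - a \<bullet> p) = sgn (u \<bullet> \<pi> x - \<beta>)"
      using down by blast
    have zero: "u \<bullet> \<pi> x = \<beta>" if "x \<in> \<Delta> - {p}" for x
    proof -
      have "sgn (u \<bullet> \<pi> x - \<beta>) = 0"
        using u on[of x] that \<Delta>(1) bp by (metis Diff_iff diff_self sgn_0 subsetD)
      then show ?thesis by (simp add: sgn_zero_iff)
    qed
    have card\<Delta>p: "card (\<Delta> - {p}) = DIM('b)"
      using \<Delta> dim by simp
    \<comment> \<open>The projection leaves \<open>u = 0\<close> open. In that case a point of
      \<open>\<Delta> - {p}\<close> forces \<beta> to vanish as well, and all signs being zero puts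
      \<open>S\<close> into one hyperplane.\<close>
    have "u \<noteq> 0"
    proof
      assume "u = 0"
      obtain x where "x \<in> \<Delta> - {p}"
        using card\<Delta>p DIM_positive[where 'a='b] by (metis card.empty equals0I less_irrefl)
      then have "\<beta> = 0"
        using zero \<open>u = 0\<close> by force
      then have "a \<bullet> x = b" if "x \<in> S" for x
        using u that \<open>u = 0\<close> bp by (cases "x = p") (auto simp: sgn_zero_iff)
      then show False
        using general_linear_position_not_subset_hyperplane[OF glp fin ab(1), of b] by blast
    qed
    let ?\<Delta>' = "\<pi> ` (\<Delta> - {p})" and ?H' = "{y. u \<bullet> y > \<beta>}"
    have sub': "?\<Delta>' \<subseteq> S'"
      unfolding S'_def using \<Delta>(1) by blast
    have card\<Delta>': "card ?\<Delta>' = DIM('b)"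
      using card\<Delta>p card_image inj_on_subset[OF inj] \<Delta>(1) by (metis Diff_mono order_refl)
    have indep: "\<not> affine_dependent ?\<Delta>'"
      using general_linear_position_extend[OF glp' finS' sub'] card\<Delta>'
      by (metis affine_dependent_subset le_add1)
    have hull: "affine hull ?\<Delta>' = {y. u \<bullet> y = \<beta>}"
      using affine_hull_eq_hyperplane[OF indep card\<Delta>' \<open>u \<noteq> 0\<close>] zero by blast
    have side: "\<pi> x \<in> ?H' \<longleftrightarrow> x \<in> H" if "x \<in> S - {p}" for x
    proof -
      have "u \<bullet> \<pi> x - \<beta> > 0 \<longleftrightarrow> a \<bullet> x - a \<bullet> p > 0"
        using u that by (metis sgn_greater)
      then show ?thesis
        using ab(3) bp by simp
    qed
    \<comment> \<open>Since \<open>p\<close> is on the boundary of \<open>H\<close>, removing it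
      leaves the count \<open>k\<close> unchanged.\<close>
    have "p \<notin> H"
      using ab(3) bp by simp
    then have SH: "S' \<inter> ?H' = \<pi> ` (S \<inter> H)"
      unfolding S'_def using side by blast
    have "S \<inter> H \<subseteq> S - {p}"
      using \<open>p \<notin> H\<close> by blast
    then have "card (S' \<inter> ?H') = k"
      unfolding SH using cardH card_image inj_on_subset[OF inj] by metis
    then have "(?\<Delta>', ?H') \<in> k_facets k S'"
      unfolding k_facets_def using sub' card\<Delta>' hull \<open>u \<noteq> 0\<close> by blast
    then show ?thesis
      using SH F by (metis fst_conv snd_conv)
  qed
  then obtain g where g: "\<And>F. F \<in> A \<Longrightarrow> g F \<in> k_facets k S'"
    "\<And>F. F \<in> A \<Longrightarrow> fst (g F) = \<pi> ` (fst F - {p})"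
    "\<And>F. F \<in> A \<Longrightarrow> S' \<inter> snd (g F) = \<pi> ` (S \<inter> snd F)"
    by metis
  have "inj_on g A"
  proof (rule inj_onI)
    fix F G assume FG: "F \<in> A" "G \<in> A" "g F = g G"
    \<comment> \<open>\<pi> is injective only on \<open>S - {p}\<close>, so the sets compared
      through their images must avoid \<open>p\<close>.\<close>
    have A: "fst F \<subseteq> S" "p \<in> fst F" "S \<inter> snd F \<subseteq> S - {p}" if FA: "F \<in> A" for F
    proof -
      obtain a b where "affine hull (fst F) = {x. a \<bullet> x = b}" "snd F = {x. a \<bullet> x > b}"
        using FA unfolding A_def k_facets_def by auto
      moreover show "fst F \<subseteq> S" "p \<in> fst F"
        using FA unfolding A_def k_facets_def by auto
      ultimately show "S \<inter> snd F \<subseteq> S - {p}"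
        using hull_inc[of p "fst F" affine] by auto
    qed
    have "fst F - {p} = fst G - {p}"
      using inj_on_image_eq_iff[OF inj] g(2) FG A(1) by (metis Diff_mono order_refl)
    then have 1: "fst F = fst G"
      using A(2) FG by blast
    have "S \<inter> snd F = S \<inter> snd G"
      using inj_on_image_eq_iff[OF inj] g(3) FG A(3) by metis
    moreover have "(fst F, snd F) \<in> k_facets k S" "(fst F, snd G) \<in> k_facets k S"
      using FG(1,2) 1 unfolding A_def mem_Collect_eq by (metis prod.collapse)+
    ultimately have "snd F = snd G"
      using k_facets_snd_eqI[OF glp fin] by blast
    with 1 show "F = G"
      by (simp add: prod_eq_iff)
  qed
  then have "card A \<le> num_k_facets k S'"
    unfolding num_k_facets_def
    using card_inj_on_le g(1) finite_k_facets[OF glp' finS'] by (metis image_subsetI)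
  also have "\<dots> \<le> max_num_k_facets TYPE('b) k (card S - 1)"
    using num_k_facets_le_max[OF glp' finS'] cardS' by simp
  finally show ?thesis
    unfolding A_def .
qed

section \<open>Double counting over the points\<close>

text \<open>Incidences between points and k-facets are counted in two ways; each k-facet has exactly
  \<open>DIM('a)\<close> points.\<close>

lemma sum_card_k_facets_at_point:
  fixes S :: "'a::euclidean_space set"
  assumes "general_linear_position S" "finite S"
  shows "(\<Sum>p\<in>S. card {F \<in> k_facets k S. p \<in> fst F}) = DIM('a) * num_k_facets k S"
proof -
  have "card {p \<in> S. p \<in> fst F} = DIM('a)" if "F \<in> k_facets k S" for F
  proof -
    have "fst F \<subseteq> S" "card (fst F) = DIM('a)"
      using that unfolding k_facets_def by auto
    moreover from this(1) have "{p \<in> S. p \<in> fst F} = fst F"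
      by blast
    ultimately show ?thesis
      by simp
  qed
  then have "(\<Sum>p\<in>S. card {F \<in> k_facets k S. p \<in> fst F}) = DIM('a) * card (k_facets k S)"
    using sum_multicount[OF assms(2) finite_k_facets[OF assms], of k "\<lambda>p F. p \<in> fst F"] by simp
  then show ?thesis
    by (simp add: num_k_facets_def)
qed

theorem theorem3p12:
  fixes d k n :: nat and S :: "(real ^ 'd) set"
  assumes "d \<ge> 2"
    and "CARD('d) = d"
    and "CARD('e) = d - 1"
    and "finite S" and "card S = n"
    and "convex_position S"
    and "general_linear_position S"
  shows "real (num_k_facets k S)
           \<le> real n / real d * real (max_num_k_facets TYPE(real ^ 'e) k (n - 1))"
proof -
  let ?M = "max_num_k_facets TYPE(real ^ 'e) k (n - 1)"
  have dim: "DIM(real ^ 'd) = DIM(real ^ 'e) + 1"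
    using assms(1-3) by simp
  have "d * num_k_facets k S = (\<Sum>p\<in>S. card {F \<in> k_facets k S. p \<in> fst F})"
    using sum_card_k_facets_at_point[OF assms(7,4)] assms(2) by simp
  \<comment> \<open>Each of the \<open>n\<close> summands is at most \<open>?M\<close> by projection
    from its point.\<close>
  also have "\<dots> \<le> n * ?M"
    using sum_bounded_above[of S "\<lambda>p. card {F \<in> k_facets k S. p \<in> fst F}" ?M]
      card_k_facets_at_point_le[OF dim assms(6,7)] assms(5) by simp
  finally have "real d * real (num_k_facets k S) \<le> real n * real ?M"
    by (metis of_nat_le_iff of_nat_mult)
  then show ?thesis
    using assms(1) by (simp add: field_simps)
qed

end
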